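(* Let $\mathcal A,\mathcal B$ be unital Banach algebras with units $1_{\mathcal A},1_{\mathcal B}$, let $\mathcal M$ be a unital Banach $\mathcal A$-$\mathcal B$-bimodule, let $\mathcal T=\mathrm{Tri}(\mathcal A,\mathcal M,\mathcal B)$, and let $\sigma,\tau:\mathcal T\to\mathcal T$ be continuous homomorphisms with $\sigma(1_{\mathcal A}\oplus 0)=\tau(1_{\mathcal A}\oplus 0)=1_{\mathcal A}\oplus 0$ and $\sigma(0\oplus 1_{\mathcal B})=\tau(0\oplus 1_{\mathcal B})=0\oplus 1_{\mathcal B}$. Let $\mathcal X$ be a unital Banach $\mathcal T$-bimodule such that $\mathcal X_{\mathcal A\mathcal B}=1_{\mathcal A}\mathcal X1_{\mathcal B}=0$. Then $$H^1_{(\sigma,\tau)}(\mathcal T,\mathcal X)=H^1_{(\sigma,\tau)}(\mathcal A,\mathcal X_{\mathcal A\mathcal A})\oplus H^1_{(\sigma,\tau)}(\mathcal B,\mathcal X_{\mathcal B\mathcal B})$$ (equality meaning isomorphism of vector spaces), where $\mathcal X_{\mathcal A\mathcal A}=1_{\mathcal A}\mathcal X1_{\mathcal A}$ and $\mathcal X_{\mathcal B\mathcal B}=1_{\mathcal B}\mathcal X1_{\mathcal B}$.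
   Context: $\mathrm{Tri}(\mathcal A,\mathcal M,\mathcal B)$ is the algebra of matrices $\begin{bmatrix}a&m\\0&b\end{bmatrix}$ ($a\in\mathcal A$, $m\in\mathcal M$, $b\in\mathcal B$) with the usual matrix addition and multiplication and the norm $\|a\|+\|m\|+\|b\|$. A unital Banach $\mathcal A$-$\mathcal B$-bimodule satisfies $a(mb)=(am)b$ and $1_{\mathcal A}m=m1_{\mathcal B}=m$. Write $a\oplus b=\begin{bmatrix}a&0\\0&b\end{bmatrix}$; identify $a\in\mathcal A$ with $a\oplus 0$ and $b\in\mathcal B$ with $0\oplus b$, so that $1_{\mathcal A}$ and $1_{\mathcal B}$ act on any $\mathcal T$-bimodule. The conditions on $\sigma,\tau$ imply $\sigma(\mathcal A)\subseteq\mathcal A$, $\sigma(\mathcal B)\subseteq\mathcal B$ and likewise for $\tau$; the restrictions of $\sigma,\tau$ to $\mathcal A$ and to $\mathcal B$ are denoted again by $\sigma,\tau$. For a Banach algebra $\mathcal C$, continuous homomorphisms $\sigma,\tau:\mathcal C\to\mathcal C$ and a Banach $\mathcal C$-bimodule $\mathcal E$: a $(\sigma,\tau)$-derivation is a linear map $d:\mathcal C\to\mathcal E$ with $d(ab)=d(a)\sigma(b)+\tau(a)d(b)$ for all $a,b\in\mathcal C$; it is $(\sigma,\tau)$-inner if there is $x\in\mathcal E$ with $d(a)=\tau(a)x-x\sigma(a)$ for all $a$. $Z^1_{(\sigma,\tau)}(\mathcal C,\mathcal E)$ is the space of continuous $(\sigma,\tau)$-derivations, $B^1_{(\sigma,\tau)}(\mathcal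 C,\mathcal E)$ the subspace of $(\sigma,\tau)$-inner ones, and $H^1_{(\sigma,\tau)}(\mathcal C,\mathcal E)=Z^1_{(\sigma,\tau)}(\mathcal C,\mathcal E)/B^1_{(\sigma,\tau)}(\mathcal C,\mathcal E)$. *)

theory Defs
  imports
    "HOL-Analysis.Analysis"
    "HOL-Library.Function_Algebras"
    "HOL-Library.Set_Algebras"
begin

section \<open>Banach spaces, algebras and bimodules over the scalar field\<close>

text \<open>
  The scalars range over an arbitrary type \<open>'k\<close> of class \<open>real_normed_field\<close>, i.e. over the
  reals or the complex numbers. The type classes of HOL-Analysis only know the underlying real
  structure, so the scalar multiplication by \<open>'k\<close> is an explicit parameter.
\<close>

locale banach_space = vector_space scale
  for scale :: "'k::real_normed_field \<Rightarrow> 'v::banach \<Rightarrow> 'v" +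
  assumes norm_scale: "norm (scale c x) = norm c * norm x"
    and scale_of_real: "scale (of_real r) x = r *\<^sub>R x"

text \<open>
  The sort of \<open>'a\<close> gives completeness, submultiplicativity of the norm and a two-sided unit \<open>1\<close>.
  Neither \<open>norm 1 = 1\<close> nor \<open>1 \<noteq> 0\<close> is required.
\<close>

locale unital_banach_algebra = banach_space scale
  for scale :: "'k::real_normed_field \<Rightarrow> 'a::{real_normed_algebra,monoid_mult,banach} \<Rightarrow> 'a" +
  assumes scale_mult_left: "scale c x * y = scale c (x * y)"
    and scale_mult_right: "x * scale c y = scale c (x * y)"

text \<open>
  The algebras acting on the left and on the right are given by their scalar multiplication,
  product and unit, because the product of the triangular algebra depends on the module actions
  and hence is not a type class operation. The actions are bounded by some constant
  (\<open>bounded_bilinear\<close>), not necessarily by \<open>1\<close>; with constant \<open>1\<close> on \<open>M\<close> the norm of the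
  triangular algebra below is submultiplicative, in general it is so up to a constant.
\<close>

locale unital_banach_bimodule =
  A: banach_space scaleA + B: banach_space scaleB + banach_space scale +
  L: bounded_bilinear lact + R: bounded_bilinear ract
  for scaleA :: "'k::real_normed_field \<Rightarrow> 'a::banach \<Rightarrow> 'a"
    and multA :: "'a \<Rightarrow> 'a \<Rightarrow> 'a" and oneA :: 'a
    and scaleB :: "'k \<Rightarrow> 'b::banach \<Rightarrow> 'b"
    and multB :: "'b \<Rightarrow> 'b \<Rightarrow> 'b" and oneB :: 'b
    and scale :: "'k \<Rightarrow> 'm::banach \<Rightarrow> 'm"
    and lact :: "'a \<Rightarrow> 'm \<Rightarrow> 'm" and ract :: "'m \<Rightarrow> 'b \<Rightarrow> 'm" +
  assumes lact_scale_left: "lact (scaleA c a) x = scale c (lact a x)"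
    and lact_scale_right: "lact a (scale c x) = scale c (lact a x)"
    and ract_scale_left: "ract (scale c x) b = scale c (ract x b)"
    and ract_scale_right: "ract x (scaleB c b) = scale c (ract x b)"
    and lact_mult: "lact (multA a a') x = lact a (lact a' x)"
    and ract_mult: "ract x (multB b b') = ract (ract x b) b'"
    and lact_ract: "lact a (ract x b) = ract (lact a x) b"
    and lact_one: "lact oneA x = x"
    and ract_one: "ract x oneB = x"


section \<open>The triangular algebra\<close>

text \<open>\<open>Tri a m b\<close> is the upper triangular matrix with diagonal \<open>a, b\<close> and corner \<open>m\<close>.\<close>

datatype ('a, 'm, 'b) tri = Tri (tri_a: 'a) (tri_m: 'm) (tri_b: 'b)

instantiation tri :: (real_vector, real_vector, real_vector) real_vector
begin

definition "0 = Tri 0 0 0"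
definition "s + t = Tri (tri_a s + tri_a t) (tri_m s + tri_m t) (tri_b s + tri_b t)"
definition "s - t = Tri (tri_a s - tri_a t) (tri_m s - tri_m t) (tri_b s - tri_b t)"
definition "- t = Tri (- tri_a t) (- tri_m t) (- tri_b t)"
definition "r *\<^sub>R t = Tri (r *\<^sub>R tri_a t) (r *\<^sub>R tri_m t) (r *\<^sub>R tri_b t)"

instance
  by standard (simp_all add: zero_tri_def plus_tri_def minus_tri_def uminus_tri_def scaleR_tri_def
      add.assoc add.commute scaleR_add_right scaleR_add_left)

end

instantiation tri :: (real_normed_vector, real_normed_vector, real_normed_vector) real_normed_vector
begin

definition "norm t = norm (tri_a t) + norm (tri_m t) + norm (tri_b t)"
definition "sgn t = t /\<^sub>R norm t" for t :: "('a, 'b, 'c) tri"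
definition "dist s t = norm (s - t)" for s t :: "('a, 'b, 'c) tri"
definition uniformity_tri_def:
  "(uniformity :: (('a, 'b, 'c) tri \<times> ('a, 'b, 'c) tri) filter) =
    (INF e\<in>{0<..}. principal {(s, t). dist s t < e})"
definition open_tri_def:
  "open (U :: ('a, 'b, 'c) tri set) \<longleftrightarrow> (\<forall>s\<in>U. \<forall>\<^sub>F (s', t) in uniformity. s' = s \<longrightarrow> t \<in> U)"

instance
proof
  fix s t :: "('a, 'b, 'c) tri" and r :: real
  show "norm t = 0 \<longleftrightarrow> t = 0"
    by (cases t) (simp add: norm_tri_def zero_tri_def add_nonneg_eq_0_iff)
  show "norm (s + t) \<le> norm s + norm t"
    using norm_triangle_ineq[of "tri_a s" "tri_a t"] norm_triangle_ineq[of "tri_m s" "tri_m t"]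
      norm_triangle_ineq[of "tri_b s" "tri_b t"]
    by (simp add: norm_tri_def plus_tri_def)
  show "norm (r *\<^sub>R t) = \<bar>r\<bar> * norm t"
    by (simp add: norm_tri_def scaleR_tri_def algebra_simps)
qed (rule sgn_tri_def dist_tri_def uniformity_tri_def open_tri_def)+

end

lemma bounded_linear_tri_a: "bounded_linear tri_a"
  by (rule bounded_linear_intro[where K = 1]) (simp_all add: plus_tri_def scaleR_tri_def norm_tri_def)

lemma bounded_linear_tri_m: "bounded_linear tri_m"
  by (rule bounded_linear_intro[where K = 1]) (simp_all add: plus_tri_def scaleR_tri_def norm_tri_def)

lemma bounded_linear_tri_b: "bounded_linear tri_b"
  by (rule bounded_linear_intro[where K = 1]) (simp_all add: plus_tri_def scaleR_tri_def norm_tri_def)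

instance tri :: (banach, banach, banach) banach
proof
  fix X :: "nat \<Rightarrow> ('a, 'b, 'c) tri"
  assume X: "Cauchy X"
  obtain a where a: "(\<lambda>n. tri_a (X n)) \<longlonglongrightarrow> a"
    using Cauchy_convergent[OF bounded_linear.Cauchy[OF bounded_linear_tri_a X]]
    unfolding convergent_def by blast
  obtain m where m: "(\<lambda>n. tri_m (X n)) \<longlonglongrightarrow> m"
    using Cauchy_convergent[OF bounded_linear.Cauchy[OF bounded_linear_tri_m X]]
    unfolding convergent_def by blast
  obtain b where b: "(\<lambda>n. tri_b (X n)) \<longlonglongrightarrow> b"
    using Cauchy_convergent[OF bounded_linear.Cauchy[OF bounded_linear_tri_b X]]
    unfolding convergent_def by blast
  have "(\<lambda>n. norm (tri_a (X n) - a) + norm (tri_m (X n) - m) + norm (tri_b (X n) - b)) \<longlonglongrightarrow> 0"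
    by (intro tendsto_add_zero tendsto_norm_zero LIM_zero a m b)
  then have "(\<lambda>n. norm (X n - Tri a m b)) \<longlonglongrightarrow> 0"
    by (simp add: norm_tri_def minus_tri_def)
  then show "convergent X"
    by (rule convergentI[OF LIM_zero_cancel[OF tendsto_norm_zero_cancel]])
qed

definition tri_scale ::
  "('k \<Rightarrow> 'a \<Rightarrow> 'a) \<Rightarrow> ('k \<Rightarrow> 'm \<Rightarrow> 'm) \<Rightarrow> ('k \<Rightarrow> 'b \<Rightarrow> 'b) \<Rightarrow> 'k \<Rightarrow> ('a, 'm, 'b) tri \<Rightarrow> ('a, 'm, 'b) tri"
  where "tri_scale scaleA scaleM scaleB c t =
    Tri (scaleA c (tri_a t)) (scaleM c (tri_m t)) (scaleB c (tri_b t))"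

definition tri_mult ::
  "('a::times \<Rightarrow> 'm::plus \<Rightarrow> 'm) \<Rightarrow> ('m \<Rightarrow> 'b::times \<Rightarrow> 'm) \<Rightarrow>
    ('a, 'm, 'b) tri \<Rightarrow> ('a, 'm, 'b) tri \<Rightarrow> ('a, 'm, 'b) tri"
  where "tri_mult lact ract s t =
    Tri (tri_a s * tri_a t) (lact (tri_a s) (tri_m t) + ract (tri_m s) (tri_b t)) (tri_b s * tri_b t)"

definition tri_diag :: "'a \<Rightarrow> 'b \<Rightarrow> ('a, 'm::zero, 'b) tri"
  where "tri_diag a b = Tri a 0 b"

definition tri_one :: "('a::one, 'm::zero, 'b::one) tri"
  where "tri_one = tri_diag 1 1"


section \<open>Continuous homomorphisms and their restrictions to the diagonal algebras\<close>

definition continuous_hom ::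
  "('k::field \<Rightarrow> 'c::real_normed_vector \<Rightarrow> 'c) \<Rightarrow> ('c \<Rightarrow> 'c \<Rightarrow> 'c) \<Rightarrow> ('c \<Rightarrow> 'c) \<Rightarrow> bool"
  where "continuous_hom scaleC multC \<sigma> \<longleftrightarrow>
    Vector_Spaces.linear scaleC scaleC \<sigma> \<and> (\<forall>s t. \<sigma> (multC s t) = multC (\<sigma> s) (\<sigma> t)) \<and>
    continuous_on UNIV \<sigma>"

text \<open>
  With \<open>a\<close> identified with \<open>tri_diag a 0\<close> and \<open>b\<close> with \<open>tri_diag 0 b\<close>, these are the restrictions
  of \<open>\<sigma>\<close> to \<open>A\<close> and to \<open>B\<close>; see \<open>restrict_A_eq\<close> and \<open>restrict_B_eq\<close> below.
\<close>

definition restrict_A ::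
  "(('a, 'm::zero, 'b::zero) tri \<Rightarrow> ('a, 'm, 'b) tri) \<Rightarrow> 'a \<Rightarrow> 'a"
  where "restrict_A \<sigma> a = tri_a (\<sigma> (tri_diag a 0))"

definition restrict_B ::
  "(('a::zero, 'm::zero, 'b) tri \<Rightarrow> ('a, 'm, 'b) tri) \<Rightarrow> 'b \<Rightarrow> 'b"
  where "restrict_B \<sigma> b = tri_b (\<sigma> (tri_diag 0 b))"

lemma restrict_A_eq:
  fixes \<sigma> :: "('a::{real_normed_algebra,monoid_mult,banach}, 'm::banach,
      'b::{real_normed_algebra,monoid_mult,banach}) tri \<Rightarrow> ('a, 'm, 'b) tri"
  assumes M: "unital_banach_bimodule scaleA (*) 1 scaleB (*) 1 scaleM lact ract"
    and \<sigma>: "continuous_hom scaleT (tri_mult lact ract) \<sigma>"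
    and e: "\<sigma> (tri_diag 1 0) = tri_diag 1 0"
  shows "\<sigma> (tri_diag a 0) = tri_diag (restrict_A \<sigma> a) 0"
proof -
  interpret M: unital_banach_bimodule scaleA "(*)" 1 scaleB "(*)" 1 scaleM lact ract
    by (rule M)
  have "tri_mult lact ract (tri_diag a 0) (tri_diag 1 0) = tri_diag a 0"
    by (simp add: tri_diag_def tri_mult_def M.L.zero_right M.R.zero_left)
  moreover have "\<sigma> (tri_mult lact ract s t) = tri_mult lact ract (\<sigma> s) (\<sigma> t)" for s t
    using \<sigma> by (simp add: continuous_hom_def)
  ultimately have "\<sigma> (tri_diag a 0) = tri_mult lact ract (\<sigma> (tri_diag a 0)) (\<sigma> (tri_diag 1 0))"
    by metis
  also have "\<dots> = tri_diag (restrict_A \<sigma> a) 0"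
    unfolding e by (simp add: tri_diag_def tri_mult_def restrict_A_def M.L.zero_right M.R.zero_right)
  finally show ?thesis .
qed

lemma restrict_B_eq:
  fixes \<sigma> :: "('a::{real_normed_algebra,monoid_mult,banach}, 'm::banach,
      'b::{real_normed_algebra,monoid_mult,banach}) tri \<Rightarrow> ('a, 'm, 'b) tri"
  assumes M: "unital_banach_bimodule scaleA (*) 1 scaleB (*) 1 scaleM lact ract"
    and \<sigma>: "continuous_hom scaleT (tri_mult lact ract) \<sigma>"
    and f: "\<sigma> (tri_diag 0 1) = tri_diag 0 1"
  shows "\<sigma> (tri_diag 0 b) = tri_diag 0 (restrict_B \<sigma> b)"
proof -
  interpret M: unital_banach_bimodule scaleA "(*)" 1 scaleB "(*)" 1 scaleM lact ract
    by (rule M)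
  have "tri_mult lact ract (tri_diag 0 1) (tri_diag 0 b) = tri_diag 0 b"
    by (simp add: tri_diag_def tri_mult_def M.L.zero_right M.R.zero_left)
  moreover have "\<sigma> (tri_mult lact ract s t) = tri_mult lact ract (\<sigma> s) (\<sigma> t)" for s t
    using \<sigma> by (simp add: continuous_hom_def)
  ultimately have "\<sigma> (tri_diag 0 b) = tri_mult lact ract (\<sigma> (tri_diag 0 1)) (\<sigma> (tri_diag 0 b))"
    by metis
  also have "\<dots> = tri_diag 0 (restrict_B \<sigma> b)"
    unfolding f by (simp add: tri_diag_def tri_mult_def restrict_B_def M.L.zero_left M.R.zero_left)
  finally show ?thesis .
qed


section \<open>Vector spaces given by carriers; quotients and direct sums\<close>

record ('k, 'v) vspace =
  carrier :: "'v set"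
  add :: "'v \<Rightarrow> 'v \<Rightarrow> 'v"
  smult :: "'k \<Rightarrow> 'v \<Rightarrow> 'v"

text \<open>
  The quotient \<open>Z / W\<close> of a subspace \<open>Z\<close> by a subspace \<open>W \<subseteq> Z\<close>; its elements are the cosets
  \<open>z +o W\<close>. Adding \<open>W\<close> in \<open>smult\<close> only matters for \<open>c = 0\<close>, where scaling a coset elementwise
  gives \<open>{0}\<close> rather than \<open>W\<close>.
\<close>

definition quotient_space ::
  "('k \<Rightarrow> 'v \<Rightarrow> 'v) \<Rightarrow> 'v set \<Rightarrow> 'v::ab_group_add set \<Rightarrow> ('k, 'v set) vspace"
  where "quotient_space scl Z W =
    \<lparr>carrier = (\<lambda>z. z +o W) ` Z,
     add = (\<lambda>U V. U + V),
     smult = (\<lambda>c U. scl c ` U + W)\<rparr>"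

definition direct_sum_space :: "('k, 'u) vspace \<Rightarrow> ('k, 'v) vspace \<Rightarrow> ('k, 'u \<times> 'v) vspace"
  where "direct_sum_space U V =
    \<lparr>carrier = carrier U \<times> carrier V,
     add = (\<lambda>(u, v) (u', v'). (add U u u', add V v v')),
     smult = (\<lambda>c (u, v). (smult U c u, smult V c v))\<rparr>"

definition isomorphic_spaces :: "('k, 'u) vspace \<Rightarrow> ('k, 'v) vspace \<Rightarrow> bool"
  where "isomorphic_spaces U V \<longleftrightarrow>
    (\<exists>\<phi>. bij_betw \<phi> (carrier U) (carrier V) \<and>
      (\<forall>x\<in>carrier U. \<forall>y\<in>carrier U. \<phi> (add U x y) = add V (\<phi> x) (\<phi> y)) \<and>
      (\<forall>c. \<forall>x\<in>carrier U. \<phi> (smult U c x) = smult V c (\<phi> x)))"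

lemma quotient_space_add:
  assumes W: "module.subspace scl W" and vs: "vector_space scl"
  shows "add (quotient_space scl Z W) (x +o W) (y +o W) = (x + y) +o W"
proof -
  interpret vector_space scl by (rule vs)
  have "W + W = W"
  proof (intro equalityI subsetI)
    fix w assume "w \<in> W"
    then show "w \<in> W + W"
      using set_plus_intro[of w W 0 W] subspace_0[OF W] by simp
  qed (auto simp: set_plus_def intro: subspace_add[OF W])
  then show ?thesis
    by (simp add: quotient_space_def set_plus_rearrange)
qed

lemma quotient_space_smult:
  assumes W: "module.subspace scl W" and vs: "vector_space scl"
  shows "smult (quotient_space scl Z W) c (x +o W) = scl c x +o W"
proof -
  interpret vector_space scl by (rule vs)
  show ?thesis
  proof (intro equalityI subsetI)
    fix y assume "y \<in> smult (quotient_space scl Z W) c (x +o W)"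
    then obtain u w where "u \<in> W" "w \<in> W" "y = scl c (x + u) + w"
      by (auto simp: quotient_space_def set_plus_def elt_set_plus_def)
    then show "y \<in> scl c x +o W"
      using subspace_add[OF W subspace_scale[OF W]]
      by (auto simp: elt_set_plus_def scale_right_distrib add.assoc)
  next
    fix y assume "y \<in> scl c x +o W"
    then obtain w where w: "w \<in> W" "y = scl c x + w"
      by (auto simp: elt_set_plus_def)
    moreover have "x \<in> x +o W"
      using set_plus_intro2[OF subspace_0[OF W], of x] by simp
    ultimately show "y \<in> smult (quotient_space scl Z W) c (x +o W)"
      by (auto simp: quotient_space_def set_plus_def)
  qed
qed


section \<open>Derivations and first cohomology\<close>

text \<open>
  The algebra \<open>C\<close> is the whole type \<open>'c\<close>. The bimodule \<open>E\<close> is a subspace of \<open>'x\<close>; it is a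
  parameter because the coefficients of interest include subspaces such as \<open>e X e\<close>. Elements of
  \<open>Z1\<close> are maps \<open>'c \<Rightarrow> 'x\<close> with values in \<open>E\<close>.
\<close>

definition is_derivation ::
  "('k::field \<Rightarrow> 'c::ab_group_add \<Rightarrow> 'c) \<Rightarrow> ('c \<Rightarrow> 'c \<Rightarrow> 'c) \<Rightarrow> ('k \<Rightarrow> 'x::ab_group_add \<Rightarrow> 'x) \<Rightarrow>
    'x set \<Rightarrow> ('c \<Rightarrow> 'x \<Rightarrow> 'x) \<Rightarrow> ('x \<Rightarrow> 'c \<Rightarrow> 'x) \<Rightarrow> ('c \<Rightarrow> 'c) \<Rightarrow> ('c \<Rightarrow> 'c) \<Rightarrow> ('c \<Rightarrow> 'x) \<Rightarrow> bool"
  where "is_derivation scaleC multC scaleX E lact ract \<sigma> \<tau> d \<longleftrightarrow>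
    Vector_Spaces.linear scaleC scaleX d \<and> range d \<subseteq> E \<and>
    (\<forall>a b. d (multC a b) = ract (d a) (\<sigma> b) + lact (\<tau> a) (d b))"

definition is_inner ::
  "'x set \<Rightarrow> ('c \<Rightarrow> 'x \<Rightarrow> 'x) \<Rightarrow> ('x \<Rightarrow> 'c \<Rightarrow> 'x) \<Rightarrow> ('c \<Rightarrow> 'c) \<Rightarrow> ('c \<Rightarrow> 'c) \<Rightarrow>
    ('c \<Rightarrow> 'x::ab_group_add) \<Rightarrow> bool"
  where "is_inner E lact ract \<sigma> \<tau> d \<longleftrightarrow> (\<exists>x\<in>E. \<forall>a. d a = lact (\<tau> a) x - ract x (\<sigma> a))"

definition Z1 ::
  "('k::field \<Rightarrow> 'c::real_normed_vector \<Rightarrow> 'c) \<Rightarrow> ('c \<Rightarrow> 'c \<Rightarrow> 'c) \<Rightarrow>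
    ('k \<Rightarrow> 'x::real_normed_vector \<Rightarrow> 'x) \<Rightarrow> 'x set \<Rightarrow> ('c \<Rightarrow> 'x \<Rightarrow> 'x) \<Rightarrow> ('x \<Rightarrow> 'c \<Rightarrow> 'x) \<Rightarrow>
    ('c \<Rightarrow> 'c) \<Rightarrow> ('c \<Rightarrow> 'c) \<Rightarrow> ('c \<Rightarrow> 'x) set"
  where "Z1 scaleC multC scaleX E lact ract \<sigma> \<tau> =
    {d. is_derivation scaleC multC scaleX E lact ract \<sigma> \<tau> d \<and> continuous_on UNIV d}"

definition B1 ::
  "('k::field \<Rightarrow> 'c::real_normed_vector \<Rightarrow> 'c) \<Rightarrow> ('c \<Rightarrow> 'c \<Rightarrow> 'c) \<Rightarrow>
    ('k \<Rightarrow> 'x::real_normed_vector \<Rightarrow> 'x) \<Rightarrow> 'x set \<Rightarrow> ('c \<Rightarrow> 'x \<Rightarrow> 'x) \<Rightarrow> ('x \<Rightarrow> 'c \<Rightarrow> 'x) \<Rightarrow>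
    ('c \<Rightarrow> 'c) \<Rightarrow> ('c \<Rightarrow> 'c) \<Rightarrow> ('c \<Rightarrow> 'x) set"
  where "B1 scaleC multC scaleX E lact ract \<sigma> \<tau> =
    {d \<in> Z1 scaleC multC scaleX E lact ract \<sigma> \<tau>. is_inner E lact ract \<sigma> \<tau> d}"

definition H1 ::
  "('k::field \<Rightarrow> 'c::real_normed_vector \<Rightarrow> 'c) \<Rightarrow> ('c \<Rightarrow> 'c \<Rightarrow> 'c) \<Rightarrow>
    ('k \<Rightarrow> 'x::real_normed_vector \<Rightarrow> 'x) \<Rightarrow> 'x set \<Rightarrow> ('c \<Rightarrow> 'x \<Rightarrow> 'x) \<Rightarrow> ('x \<Rightarrow> 'c \<Rightarrow> 'x) \<Rightarrow>
    ('c \<Rightarrow> 'c) \<Rightarrow> ('c \<Rightarrow> 'c) \<Rightarrow> ('k, ('c \<Rightarrow> 'x) set) vspace"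
  where "H1 scaleC multC scaleX E lact ract \<sigma> \<tau> =
    quotient_space (\<lambda>c d t. scaleX c (d t))
      (Z1 scaleC multC scaleX E lact ract \<sigma> \<tau>) (B1 scaleC multC scaleX E lact ract \<sigma> \<tau>)"

text \<open>The Peirce component \<open>e X f\<close>.\<close>

definition peirce :: "('c \<Rightarrow> 'x \<Rightarrow> 'x) \<Rightarrow> ('x \<Rightarrow> 'c \<Rightarrow> 'x) \<Rightarrow> 'c \<Rightarrow> 'c \<Rightarrow> 'x set"
  where "peirce lact ract e f = range (\<lambda>x. ract (lact e x) f)"

end

theory Submission
  imports Defs
begin

text \<open>
  Write \<open>e = 1\<^sub>A\<close> and \<open>f = 1\<^sub>B\<close> for the diagonal idempotents of \<open>T\<close>, so \<open>e + f = 1\<close>, \<open>f T e = 0\<close> and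
  \<open>e X f = 0\<close>. A derivation \<open>D\<close> on \<open>T\<close> has two compressions, \<open>a \<mapsto> e (D a) e\<close> on \<open>A\<close> and
  \<open>b \<mapsto> f (D b) f\<close> on \<open>B\<close>. They are derivations again, and they are inner if \<open>D\<close> is
  (\<open>compress_Z1\<close>, \<open>compress_B1\<close>).

  Conversely, \<open>f T e = 0\<close> and \<open>e X f = 0\<close> let \<open>T\<close> act on \<open>e X e\<close> through its projection onto \<open>A\<close>, and
  on \<open>f X f\<close> through its projection onto \<open>B\<close>. Derivations \<open>dA\<close> on \<open>A\<close> and \<open>dB\<close> on \<open>B\<close> therefore extend
  to \<open>T\<close> by composition with the projections, inner ones to inner ones (\<open>extend_Z1\<close>, \<open>extend_B1\<close>),
  and the sum of the two extensions has compressions \<open>dA\<close> and \<open>dB\<close>. So the pair of compressions maps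
  the derivations on \<open>T\<close> onto the pairs of derivations on \<open>A\<close> and \<open>B\<close>.

  The remaining point is that \<open>D\<close> is inner when both compressions are. Subtracting their inner
  extensions reduces this to vanishing compressions, where \<open>D\<close> is implemented by \<open>- D e\<close>
  (\<open>derivation_inner_if_corners_vanish\<close>): on the corner \<open>M = e T f\<close> this is the identity
  \<open>D m = (D e) (\<sigma> m) - (\<tau> m) (D e)\<close>, so \<open>M\<close> contributes nothing to the cohomology. The inner
  derivations are thus the preimage of the pairs of inner derivations, and passing to quotients
  (\<open>isomorphic_quotients\<close>) gives the isomorphism.
\<close>

section \<open>Isomorphisms between quotients\<close>

lemma coset_eq_iff:
  assumes "vector_space scl" and W: "module.subspace scl W"
  shows "x +o W = y +o W \<longleftrightarrow> x - y \<in> W"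
proof -
  interpret vector_space scl by fact
  have "z +o W = {u. u - z \<in> W}" for z
    by (auto simp: elt_set_plus_def) (metis add_diff_cancel_left' diff_add_cancel add.commute)
  moreover have "x - y \<in> W" if "{u. u - x \<in> W} = {u. u - y \<in> W}"
    using that subspace_0[OF W] by auto
  moreover have "u - x \<in> W \<longleftrightarrow> u - y \<in> W" if "x - y \<in> W" for u
    using subspace_add[OF W _ that, of "u - x"] subspace_diff[OF W _ that, of "u - y"] by auto
  ultimately show ?thesis by auto
qed

lemma image_coset:
  assumes p: "Vector_Spaces.linear scl scl' p"
    and W: "module.subspace scl W" and W': "module.subspace scl' W'" and "p ` W \<subseteq> W'"
  shows "p ` (z +o W) + W' = p z +o W'"
proof -
  interpret Vector_Spaces.linear scl scl' p by (rule p)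
  show ?thesis
  proof (intro equalityI subsetI)
    fix y assume "y \<in> p ` (z +o W) + W'"
    then obtain w w' where "w \<in> W" "w' \<in> W'" "y = p (z + w) + w'"
      by (auto simp: set_plus_def elt_set_plus_def)
    then show "y \<in> p z +o W'"
      using \<open>p ` W \<subseteq> W'\<close> vs2.subspace_add[OF W', of "p w" w']
      by (auto simp: elt_set_plus_def add add.assoc)
  next
    fix y assume "y \<in> p z +o W'"
    moreover have "z \<in> z +o W"
      using set_plus_intro2[OF vs1.subspace_0[OF W], of z] by simp
    ultimately show "y \<in> p ` (z +o W) + W'"
      by (auto simp: elt_set_plus_def intro!: set_plus_intro)
  qed
qed

text \<open>
  A linear map \<open>(p1, p2)\<close> from \<open>Z\<close> onto \<open>Y1 \<times> Y2\<close> under which \<open>W\<close> is the preimage of \<open>W1 \<times> W2\<close>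
  induces an isomorphism of the quotients. The induced map is written as
  \<open>U \<mapsto> (p1 ` U + W1, p2 ` U + W2)\<close>, which needs no choice of representatives.
\<close>

lemma isomorphic_quotients:
  fixes scl :: "'k::field \<Rightarrow> 'v::ab_group_add \<Rightarrow> 'v"
    and scl1 :: "'k \<Rightarrow> 'u::ab_group_add \<Rightarrow> 'u" and scl2 :: "'k \<Rightarrow> 'w::ab_group_add \<Rightarrow> 'w"
  assumes p1: "Vector_Spaces.linear scl scl1 p1" and p2: "Vector_Spaces.linear scl scl2 p2"
    and Z: "module.subspace scl Z" and W: "module.subspace scl W"
    and W1: "module.subspace scl1 W1" and W2: "module.subspace scl2 W2"
    and Y1: "p1 ` Z \<subseteq> Y1" and Y2: "p2 ` Z \<subseteq> Y2"
    and W1': "p1 ` W \<subseteq> W1" and W2': "p2 ` W \<subseteq> W2"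
    and ker: "\<And>z. z \<in> Z \<Longrightarrow> p1 z \<in> W1 \<Longrightarrow> p2 z \<in> W2 \<Longrightarrow> z \<in> W"
    and onto: "\<And>y1 y2. y1 \<in> Y1 \<Longrightarrow> y2 \<in> Y2 \<Longrightarrow> \<exists>z\<in>Z. p1 z = y1 \<and> p2 z = y2"
  shows "isomorphic_spaces (quotient_space scl Z W)
    (direct_sum_space (quotient_space scl1 Y1 W1) (quotient_space scl2 Y2 W2))"
proof -
  interpret p1: Vector_Spaces.linear scl scl1 p1 by (rule p1)
  interpret p2: Vector_Spaces.linear scl scl2 p2 by (rule p2)
  note vs = p1.vs1.vector_space_axioms p1.vs2.vector_space_axioms p2.vs2.vector_space_axioms
  define \<Phi> where "\<Phi> = (\<lambda>U. (p1 ` U + W1, p2 ` U + W2))"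
  have \<Phi>: "\<Phi> (z +o W) = (p1 z +o W1, p2 z +o W2)" for z
    by (simp add: \<Phi>_def image_coset[OF p1 W W1 W1'] image_coset[OF p2 W W2 W2'])
  show ?thesis
    unfolding isomorphic_spaces_def
  proof (intro exI[of _ \<Phi>] conjI ballI allI)
    show "bij_betw \<Phi> (carrier (quotient_space scl Z W))
      (carrier (direct_sum_space (quotient_space scl1 Y1 W1) (quotient_space scl2 Y2 W2)))"
    proof (rule bij_betw_imageI)
      show "inj_on \<Phi> (carrier (quotient_space scl Z W))"
        using p1.vs1.subspace_diff[OF Z] ker
        by (auto simp: inj_on_def quotient_space_def \<Phi> coset_eq_iff[OF vs(1) W]
            coset_eq_iff[OF vs(2) W1] coset_eq_iff[OF vs(3) W2] p1.diff p2.diff)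
      show "\<Phi> ` carrier (quotient_space scl Z W) =
        carrier (direct_sum_space (quotient_space scl1 Y1 W1) (quotient_space scl2 Y2 W2))"
      proof (intro equalityI subsetI)
        fix y
        assume "y \<in> carrier (direct_sum_space (quotient_space scl1 Y1 W1) (quotient_space scl2 Y2 W2))"
        then obtain y1 y2 where "y1 \<in> Y1" "y2 \<in> Y2" and y: "y = (y1 +o W1, y2 +o W2)"
          by (auto simp: direct_sum_space_def quotient_space_def)
        then obtain z where "z \<in> Z" "p1 z = y1" "p2 z = y2"
          using onto by blast
        then show "y \<in> \<Phi> ` carrier (quotient_space scl Z W)"
          unfolding y by (auto simp: quotient_space_def \<Phi>[symmetric])
      qed (use Y1 Y2 in \<open>auto simp: direct_sum_space_def quotient_space_def \<Phi>\<close>)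
    qed
  next
    fix x y
    assume "x \<in> carrier (quotient_space scl Z W)" "y \<in> carrier (quotient_space scl Z W)"
    then obtain u v where "x = u +o W" "y = v +o W"
      by (auto simp: quotient_space_def)
    then show "\<Phi> (add (quotient_space scl Z W) x y) =
      add (direct_sum_space (quotient_space scl1 Y1 W1) (quotient_space scl2 Y2 W2)) (\<Phi> x) (\<Phi> y)"
      by (simp add: direct_sum_space_def quotient_space_add[OF W vs(1)] \<Phi>
          quotient_space_add[OF W1 vs(2)] quotient_space_add[OF W2 vs(3)] p1.add p2.add)
  next
    fix c x
    assume "x \<in> carrier (quotient_space scl Z W)"
    then obtain u where "x = u +o W"
      by (auto simp: quotient_space_def)
    then show "\<Phi> (smult (quotient_space scl Z W) c x) =
      smult (direct_sum_space (quotient_space scl1 Y1 W1) (quotient_space scl2 Y2 W2)) c (\<Phi> x)"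
      by (simp add: direct_sum_space_def quotient_space_smult[OF W vs(1)] \<Phi>
          quotient_space_smult[OF W1 vs(2)] quotient_space_smult[OF W2 vs(3)] p1.scale p2.scale)
  qed
qed


section \<open>Spaces of derivations\<close>

lemma (in banach_space) bounded_linear_scale: "bounded_linear (scale c)"
proof (rule bounded_linear_intro)
  show "scale c (r *\<^sub>R x) = r *\<^sub>R scale c x" for r x
    by (simp add: scale_of_real[symmetric] mult.commute)
  show "norm (scale c x) \<le> norm x * norm c" for x
    by (simp add: norm_scale)
qed (rule scale_right_distrib)

lemma vector_space_pointwise:
  assumes "vector_space scl"
  shows "vector_space (\<lambda>c d t. scl c (d t))"
proof -
  interpret vector_space scl by fact
  show ?thesis
    by unfold_locales (simp_all add: fun_eq_iff scale_right_distrib scale_left_distrib)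
qed

text \<open>
  Only the linearity of each action in the module variable enters, so this covers the bimodules
  over \<open>A\<close> and \<open>B\<close> that arise by restriction of scalars as well as \<open>X\<close> itself.
\<close>

lemma
  fixes scaleC :: "'k::real_normed_field \<Rightarrow> 'c::real_normed_vector \<Rightarrow> 'c"
  assumes C: "vector_space scaleC" and X: "banach_space scaleX"
    and E: "module.subspace scaleX E"
    and l: "\<And>c. Vector_Spaces.linear scaleX scaleX (lact c)"
    and r: "\<And>c. Vector_Spaces.linear scaleX scaleX (\<lambda>x. ract x c)"
  shows subspace_Z1: "module.subspace (\<lambda>c d t. scaleX c (d t))
      (Z1 scaleC multC scaleX E lact ract \<sigma> \<tau>)" (is ?Z)
    and subspace_B1: "module.subspace (\<lambda>c d t. scaleX c (d t))
      (B1 scaleC multC scaleX E lact ract \<sigma> \<tau>)" (is ?B)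
proof -
  interpret X: banach_space scaleX by (rule X)
  interpret F: vector_space "\<lambda>c d t. scaleX c (d t)"
    by (rule vector_space_pointwise[OF X.vector_space_axioms])
  interpret C: vector_space scaleC by (rule C)
  interpret CX: vector_space_pair scaleC scaleX ..
  interpret l: Vector_Spaces.linear scaleX scaleX "lact c" for c by (rule l)
  interpret r: Vector_Spaces.linear scaleX scaleX "\<lambda>x. ract x c" for c by (rule r)
  note E_rules = X.subspace_0[OF E] X.subspace_add[OF E] X.subspace_scale[OF E]
  show Z: ?Z
  proof (rule F.subspaceI)
    show "0 \<in> Z1 scaleC multC scaleX E lact ract \<sigma> \<tau>"
      using E_rules CX.linear_zero
      by (auto simp: Z1_def is_derivation_def zero_fun_def l.zero r.zero)
  next
    fix d d'
    assume "d \<in> Z1 scaleC multC scaleX E lact ract \<sigma> \<tau>" "d' \<in> Z1 scaleC multC scaleX E lact ract \<sigma> \<tau>"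
    then show "d + d' \<in> Z1 scaleC multC scaleX E lact ract \<sigma> \<tau>"
      using E_rules CX.linear_compose_add[of d d']
      by (auto simp: Z1_def is_derivation_def plus_fun_def image_subset_iff l.add r.add
          intro!: continuous_intros)
  next
    fix k d
    assume "d \<in> Z1 scaleC multC scaleX E lact ract \<sigma> \<tau>"
    then show "(\<lambda>t. scaleX k (d t)) \<in> Z1 scaleC multC scaleX E lact ract \<sigma> \<tau>"
      using E_rules CX.linear_compose_scale_right[of d k]
      by (auto simp: Z1_def is_derivation_def image_subset_iff l.scale r.scale X.scale_right_distrib
          intro!: bounded_linear.continuous_on[OF X.bounded_linear_scale])
  qed
  show ?B
  proof (rule F.subspaceI)
    show "0 \<in> B1 scaleC multC scaleX E lact ract \<sigma> \<tau>"
      using F.subspace_0[OF Z] E_rules(1)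
      by (auto simp: B1_def is_inner_def l.zero r.zero intro!: bexI[of _ 0])
  next
    fix d d'
    assume d: "d \<in> B1 scaleC multC scaleX E lact ract \<sigma> \<tau>" "d' \<in> B1 scaleC multC scaleX E lact ract \<sigma> \<tau>"
    then obtain x x' where "x \<in> E" "x' \<in> E" "\<And>a. d a = lact (\<tau> a) x - ract x (\<sigma> a)"
      "\<And>a. d' a = lact (\<tau> a) x' - ract x' (\<sigma> a)"
      by (auto simp: B1_def is_inner_def)
    then have "is_inner E lact ract \<sigma> \<tau> (d + d')"
      using E_rules unfolding is_inner_def
      by (intro bexI[of _ "x + x'"]) (auto simp: l.add r.add)
    then show "d + d' \<in> B1 scaleC multC scaleX E lact ract \<sigma> \<tau>"
      using F.subspace_add[OF Z] d by (auto simp: B1_def)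
  next
    fix k d
    assume d: "d \<in> B1 scaleC multC scaleX E lact ract \<sigma> \<tau>"
    then obtain x where "x \<in> E" "\<And>a. d a = lact (\<tau> a) x - ract x (\<sigma> a)"
      by (auto simp: B1_def is_inner_def)
    then have "is_inner E lact ract \<sigma> \<tau> (\<lambda>t. scaleX k (d t))"
      using E_rules unfolding is_inner_def
      by (intro bexI[of _ "scaleX k x"]) (auto simp: l.scale r.scale X.scale_right_diff_distrib)
    then show "(\<lambda>t. scaleX k (d t)) \<in> B1 scaleC multC scaleX E lact ract \<sigma> \<tau>"
      using F.subspace_scale[OF Z] d by (auto simp: B1_def)
  qed
qed

section \<open>Corners of a bimodule\<close>

context unital_banach_bimodule
begin

lemma linear_lact: "Vector_Spaces.linear scale scale (lact a)"
  using vector_space_axioms by (simp add: Vector_Spaces.linear_iff L.add_right lact_scale_right)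

lemma linear_ract: "Vector_Spaces.linear scale scale (\<lambda>x. ract x b)"
  using vector_space_axioms by (simp add: Vector_Spaces.linear_iff R.add_left ract_scale_left)

lemma linear_peirce_projection: "Vector_Spaces.linear scale scale (\<lambda>x. ract (lact a x) b)"
  using Vector_Spaces.linear_compose[OF linear_lact linear_ract, unfolded comp_def] .

end

text \<open>
  The two diagonal algebras are treated alike: each is a corner \<open>C = e T e\<close> with inclusion \<open>\<iota>\<close> and
  compression \<open>\<pi>\<close>, \<open>t \<mapsto> e t e\<close>. For a general corner \<open>\<pi>\<close> is not multiplicative; here it is, because
  the matrices are triangular. That \<open>T\<close> acts on \<open>e X e\<close> through \<open>\<pi>\<close> holds on one side for the same
  reason; on the other side it says that the upper right component of \<open>X\<close> vanishes. The maps \<open>\<sigma>'\<close>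
  and \<open>\<tau>'\<close> are those induced by \<open>\<sigma>\<close> and \<open>\<tau>\<close> on \<open>C\<close>.
\<close>

locale bimodule_corner =
  X: unital_banach_bimodule scaleT multT oneT scaleT multT oneT scaleX lX rX
  for scaleT :: "'k::real_normed_field \<Rightarrow> 't::banach \<Rightarrow> 't" and multT oneT
    and scaleX :: "'k \<Rightarrow> 'x::banach \<Rightarrow> 'x" and lX rX +
  fixes scaleC :: "'k \<Rightarrow> 'c::banach \<Rightarrow> 'c" and multC :: "'c \<Rightarrow> 'c \<Rightarrow> 'c"
    and e :: 't and \<iota> :: "'c \<Rightarrow> 't" and \<pi> :: "'t \<Rightarrow> 'c"
    and \<sigma> \<tau> :: "'t \<Rightarrow> 't" and \<sigma>' \<tau>' :: "'c \<Rightarrow> 'c"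
  assumes idem: "multT e e = e"
    and incl_linear: "Vector_Spaces.linear scaleC scaleT \<iota>"
    and incl_continuous: "continuous_on UNIV \<iota>"
    and incl_mult: "\<iota> (multC a b) = multT (\<iota> a) (\<iota> b)"
    and unit_left: "multT e (\<iota> a) = \<iota> a" and unit_right: "multT (\<iota> a) e = \<iota> a"
    and proj_linear: "Vector_Spaces.linear scaleT scaleC \<pi>"
    and proj_continuous: "continuous_on UNIV \<pi>"
    and proj_mult: "\<pi> (multT s t) = multC (\<pi> s) (\<pi> t)"
    and proj_incl: "\<pi> (\<iota> a) = a"
    and \<sigma>_incl: "\<sigma> (\<iota> a) = \<iota> (\<sigma>' a)" and \<tau>_incl: "\<tau> (\<iota> a) = \<iota> (\<tau>' a)"
    and proj_\<sigma>: "\<pi> (\<sigma> t) = \<sigma>' (\<pi> t)" and proj_\<tau>: "\<pi> (\<tau> t) = \<tau>' (\<pi> t)"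
    and lact_corner: "x \<in> peirce lX rX e e \<Longrightarrow> lX t x = lX (\<iota> (\<pi> t)) x"
    and ract_corner: "x \<in> peirce lX rX e e \<Longrightarrow> rX x t = rX x (\<iota> (\<pi> t))"
begin

abbreviation "E \<equiv> peirce lX rX e e"

abbreviation "ZT \<equiv> Z1 scaleT multT scaleX UNIV lX rX \<sigma> \<tau>"
abbreviation "BT \<equiv> B1 scaleT multT scaleX UNIV lX rX \<sigma> \<tau>"
abbreviation "ZC \<equiv> Z1 scaleC multC scaleX E (\<lambda>a. lX (\<iota> a)) (\<lambda>x a. rX x (\<iota> a)) \<sigma>' \<tau>'"
abbreviation "BC \<equiv> B1 scaleC multC scaleX E (\<lambda>a. lX (\<iota> a)) (\<lambda>x a. rX x (\<iota> a)) \<sigma>' \<tau>'"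

definition compress :: "('t \<Rightarrow> 'x) \<Rightarrow> 'c \<Rightarrow> 'x"
  where "compress D = (\<lambda>a. rX (lX e (D (\<iota> a))) e)"

lemma subspace_corner: "module.subspace scaleX E"
proof -
  interpret p: Vector_Spaces.linear scaleX scaleX "\<lambda>x. rX (lX e x) e"
    by (rule X.linear_peirce_projection)
  show ?thesis
    unfolding peirce_def by (rule p.subspace_image[OF X.subspace_UNIV])
qed

lemma corner_fixed: "x \<in> E \<Longrightarrow> rX (lX e x) e = x"
  by (auto simp: peirce_def X.lact_ract X.lact_mult[symmetric] X.ract_mult[symmetric] idem)

lemma lact_incl_corner: "rX (lX e (lX (\<iota> a) x)) e = lX (\<iota> a) (rX (lX e x) e)"
  by (simp add: X.lact_ract X.lact_mult[symmetric] unit_left unit_right)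

lemma ract_incl_corner: "rX (lX e (rX x (\<iota> a))) e = rX (rX (lX e x) e) (\<iota> a)"
  by (simp add: X.lact_ract X.ract_mult[symmetric] unit_left unit_right)

lemma linear_compress:
  "Vector_Spaces.linear (\<lambda>c d t. scaleX c (d t)) (\<lambda>c d t. scaleX c (d t)) compress"
  by (simp add: Vector_Spaces.linear_iff vector_space_pointwise[OF X.vector_space_axioms]
      compress_def fun_eq_iff X.L.add_right X.R.add_left X.lact_scale_right X.ract_scale_left)

text \<open>
  Multiplication by \<open>e\<close> on both sides commutes with the actions of \<open>\<iota> a\<close>, so compressing the
  derivation identity for \<open>D (\<iota> a \<iota> b)\<close> gives the one over \<open>C\<close>.
\<close>

lemma compress_Z1:
  assumes "D \<in> ZT" shows "compress D \<in> ZC"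
proof -
  have D: "Vector_Spaces.linear scaleT scaleX D" "continuous_on UNIV D"
    and D_mult: "D (multT s t) = rX (D s) (\<sigma> t) + lX (\<tau> s) (D t)" for s t
    using assms by (auto simp: Z1_def is_derivation_def)
  have "Vector_Spaces.linear scaleC scaleX (compress D)"
    using Vector_Spaces.linear_compose[OF Vector_Spaces.linear_compose[OF incl_linear D(1)]
        X.linear_peirce_projection[of e e]]
    by (simp add: compress_def comp_def)
  moreover have "continuous_on UNIV (compress D)"
    unfolding compress_def
    by (intro bounded_linear.continuous_on[OF X.R.bounded_linear_left]
        bounded_linear.continuous_on[OF X.L.bounded_linear_right]
        continuous_on_compose2[OF D(2) incl_continuous]) auto
  moreover have "compress D (multC a b) =
      rX (compress D a) (\<iota> (\<sigma>' b)) + lX (\<iota> (\<tau>' a)) (compress D b)" for a b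
    by (simp add: compress_def incl_mult D_mult \<sigma>_incl \<tau>_incl X.L.add_right X.R.add_left
        lact_incl_corner ract_incl_corner)
  moreover have "range (compress D) \<subseteq> E"
    by (auto simp: compress_def peirce_def)
  ultimately show ?thesis
    by (simp add: Z1_def is_derivation_def)
qed

text \<open>If \<open>x\<close> implements \<open>D\<close>, then \<open>e x e\<close> implements its compression.\<close>

lemma compress_B1:
  assumes "D \<in> BT" shows "compress D \<in> BC"
proof -
  obtain x where "\<And>t. D t = lX (\<tau> t) x - rX x (\<sigma> t)"
    using assms by (auto simp: B1_def is_inner_def)
  then have "compress D a =
      lX (\<iota> (\<tau>' a)) (rX (lX e x) e) - rX (rX (lX e x) e) (\<iota> (\<sigma>' a))" for a
    by (simp add: compress_def \<sigma>_incl \<tau>_incl X.L.diff_right X.R.diff_left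
        lact_incl_corner ract_incl_corner)
  then have "is_inner E (\<lambda>a. lX (\<iota> a)) (\<lambda>x a. rX x (\<iota> a)) \<sigma>' \<tau>' (compress D)"
    unfolding is_inner_def by (intro bexI[of _ "rX (lX e x) e"]) (auto simp: peirce_def)
  then show ?thesis
    using assms compress_Z1 by (simp add: B1_def)
qed

text \<open>
  \<open>T\<close> acts on \<open>E\<close> through \<open>\<pi>\<close>, and \<open>\<pi>\<close> intertwines \<open>\<sigma>, \<tau>\<close> with \<open>\<sigma>', \<tau>'\<close>; so composing with \<open>\<pi>\<close>
  turns the derivation identity over \<open>C\<close> into the one over \<open>T\<close>, and likewise for inner maps.
\<close>

lemma extend_Z1:
  assumes "d \<in> ZC" shows "d \<circ> \<pi> \<in> ZT"
proof -
  have d: "Vector_Spaces.linear scaleC scaleX d" "continuous_on UNIV d"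
    and d_mult: "d (multC a b) = rX (d a) (\<iota> (\<sigma>' b)) + lX (\<iota> (\<tau>' a)) (d b)"
    and d_E: "d a \<in> E" for a b
    using assms by (auto simp: Z1_def is_derivation_def)
  have "d (\<pi> (multT s t)) = rX (d (\<pi> s)) (\<sigma> t) + lX (\<tau> s) (d (\<pi> t))" for s t
    by (simp add: proj_mult d_mult lact_corner[OF d_E, of "\<tau> s"] ract_corner[OF d_E, of _ "\<sigma> t"]
        proj_\<sigma> proj_\<tau>)
  moreover have "continuous_on UNIV (d \<circ> \<pi>)"
    using continuous_on_compose[OF proj_continuous] d(2) continuous_on_subset by blast
  ultimately show ?thesis
    using Vector_Spaces.linear_compose[OF proj_linear d(1)]
    by (simp add: Z1_def is_derivation_def)
qed

lemma extend_B1: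
  assumes "d \<in> BC" shows "d \<circ> \<pi> \<in> BT"
proof -
  obtain x where x: "x \<in> E" and "\<And>a. d a = lX (\<iota> (\<tau>' a)) x - rX x (\<iota> (\<sigma>' a))"
    using assms by (auto simp: B1_def is_inner_def)
  then have "(d \<circ> \<pi>) t = lX (\<tau> t) x - rX x (\<sigma> t)" for t
    by (simp add: lact_corner[OF x, of "\<tau> t"] ract_corner[OF x, of "\<sigma> t"] proj_\<sigma> proj_\<tau>)
  then show ?thesis
    using assms extend_Z1 by (auto simp: B1_def is_inner_def)
qed

lemma compress_extend:
  assumes "d \<in> ZC" shows "compress (d \<circ> \<pi>) = d"
proof -
  have "range d \<subseteq> E"
    using assms by (simp add: Z1_def is_derivation_def)
  then show ?thesis
    by (auto simp: compress_def proj_incl fun_eq_iff intro!: corner_fixed)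
qed

text \<open>
  With \<open>\<rho>\<close> the compression to a complementary corner, this makes the contributions of the two
  corners independent of each other.
\<close>

lemma compress_extend_orthogonal:
  assumes "Vector_Spaces.linear scaleC' scaleX d" and "\<And>a. \<rho> (\<iota> a) = 0"
  shows "compress (d \<circ> \<rho>) = 0"
proof -
  interpret d: Vector_Spaces.linear scaleC' scaleX d by fact
  show ?thesis
    by (simp add: compress_def fun_eq_iff assms(2) d.zero X.L.zero_right X.R.zero_left)
qed

end


section \<open>Derivations on a triangular algebra\<close>

text \<open>
  The choice of \<open>x = - D e\<close> is forced by the computation of the Peirce components of \<open>D t\<close>. Since
  \<open>D\<close> vanishes in the corners and \<open>e X f = 0\<close>, one has \<open>e (D e) = 0\<close>, so \<open>D e = f (D e)\<close>; and
  \<open>D (f e) = 0\<close> gives \<open>D f = - D e\<close>. The derivation identity for \<open>t e\<close> then determines \<open>e (D t)\<close>, the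
  one for \<open>f t\<close> determines \<open>f (D t) f\<close>, and the one for \<open>(f t) e = 0\<close> determines \<open>f (D t) e\<close>.
  The three sum up to \<open>(D e) (\<sigma> t) - (\<tau> t) (D e)\<close>.
\<close>

lemma derivation_inner_if_corners_vanish:
  assumes X: "unital_banach_bimodule scaleT multT oneT scaleT multT oneT scaleX lX rX"
    and D_add: "\<And>s t. D (s + t) = D s + D t"
    and D_mult: "\<And>s t. D (multT s t) = rX (D s) (\<sigma> t) + lX (\<tau> s) (D t)"
    and \<sigma>: "\<And>s t. \<sigma> (multT s t) = multT (\<sigma> s) (\<sigma> t)" "\<sigma> e = e" "\<sigma> f = f"
    and \<tau>: "\<And>s t. \<tau> (multT s t) = multT (\<tau> s) (\<tau> t)" "\<tau> e = e" "\<tau> f = f"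
    and idem: "multT e e = e" "multT f f = f"
    and one: "e + f = oneT"
    and lower: "\<And>t. multT (multT f t) e = 0"
    and upper: "\<And>x. rX (lX e x) f = 0"
    and corner_e: "\<And>t. rX (lX e (D (multT t e))) e = 0"
    and corner_f: "\<And>t. rX (lX f (D (multT f t))) f = 0"
  shows "D t = lX (\<tau> t) (- D e) - rX (- D e) (\<sigma> t)"
proof -
  interpret X: unital_banach_bimodule scaleT multT oneT scaleT multT oneT scaleX lX rX
    by (rule X)
  have left: "lX e x + lX f x = x" and right: "rX x e + rX x f = x" for x
    by (simp_all add: X.L.add_left[symmetric] X.R.add_right[symmetric] one X.lact_one X.ract_one)
  have eX: "rX (lX e x) e = lX e x" for x
    using right[of "lX e x"] by (simp add: upper)
  have De_e: "lX e (D e) = 0"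
    using corner_e[of e] by (simp add: idem eX)
  have De_f: "lX f (D e) = D e"
    using left[of "D e"] by (simp add: De_e)
  have D0: "D 0 = 0"
    using D_add[of 0 0] by simp
  (* The products f f and f e give the two components of D f, hence D f = - D e. *)
  have Df_f: "rX (D f) f = 0"
    using left[of "rX (D f) f"] corner_f[of f] by (simp add: idem upper X.lact_ract)
  have "lX f (D f) = D f"
    using D_mult[of f f] by (simp add: idem \<sigma> \<tau> Df_f)
  then have Df: "D f = - D e"
    using D_mult[of f e] lower[of f] right[of "D f"]
    by (simp add: idem \<sigma> \<tau> Df_f De_f D0 add_eq_0_iff)
  have e_part: "lX e (D t) = - lX e (lX (\<tau> t) (D e))"
    using corner_e[of t]
    by (simp add: D_mult \<sigma> X.L.add_right X.R.add_left eX X.lact_ract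
        eq_neg_iff_add_eq_0)
  have f_part: "rX (lX f (D t)) f = rX (rX (D e) (\<sigma> t)) f"
    using corner_f[of t]
    by (simp add: D_mult \<tau> X.L.add_right X.R.add_left X.lact_ract Df idem De_f
        X.lact_mult[symmetric] X.L.minus_right X.R.minus_left X.L.diff_right X.R.diff_left)
  have "rX (D (multT f t)) e + lX (\<tau> (multT f t)) (D e) = 0"
    using D_mult[of "multT f t" e] by (simp add: lower D0 \<sigma>)
  then have fe_part: "rX (lX f (D t)) e = rX (rX (D e) (\<sigma> t)) e - lX f (lX (\<tau> t) (D e))"
    by (simp add: D_mult \<tau> X.R.add_left Df X.R.minus_left X.R.diff_left X.lact_mult algebra_simps)
  have "D t = lX e (D t) + (rX (lX f (D t)) e + rX (lX f (D t)) f)"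
    by (simp add: left right)
  also have "\<dots> = (rX (rX (D e) (\<sigma> t)) e + rX (rX (D e) (\<sigma> t)) f) -
      (lX e (lX (\<tau> t) (D e)) + lX f (lX (\<tau> t) (D e)))"
    unfolding e_part f_part fe_part by (simp add: algebra_simps)
  also have "\<dots> = rX (D e) (\<sigma> t) - lX (\<tau> t) (D e)"
    by (simp only: left right)
  finally show ?thesis
    by (simp add: X.L.minus_right X.R.minus_left)
qed


theorem theorem2p1:
  fixes scaleA :: "'k::real_normed_field \<Rightarrow> 'a::{real_normed_algebra,monoid_mult,banach} \<Rightarrow> 'a"
    and scaleB :: "'k \<Rightarrow> 'b::{real_normed_algebra,monoid_mult,banach} \<Rightarrow> 'b"
    and scaleM :: "'k \<Rightarrow> 'm::banach \<Rightarrow> 'm"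
    and lM :: "'a \<Rightarrow> 'm \<Rightarrow> 'm" and rM :: "'m \<Rightarrow> 'b \<Rightarrow> 'm"
    and scaleT :: "'k \<Rightarrow> ('a, 'm, 'b) tri \<Rightarrow> ('a, 'm, 'b) tri"
    and multT :: "('a, 'm, 'b) tri \<Rightarrow> ('a, 'm, 'b) tri \<Rightarrow> ('a, 'm, 'b) tri"
    and \<sigma> \<tau> :: "('a, 'm, 'b) tri \<Rightarrow> ('a, 'm, 'b) tri"
    and scaleX :: "'k \<Rightarrow> 'x::banach \<Rightarrow> 'x"
    and lX :: "('a, 'm, 'b) tri \<Rightarrow> 'x \<Rightarrow> 'x" and rX :: "'x \<Rightarrow> ('a, 'm, 'b) tri \<Rightarrow> 'x"
    and eA eB :: "('a, 'm, 'b) tri"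
    and XAA XBB :: "'x set"
  assumes A: "unital_banach_algebra scaleA"
    and B: "unital_banach_algebra scaleB"
    and M: "unital_banach_bimodule scaleA (*) 1 scaleB (*) 1 scaleM lM rM"
    and scaleT_def: "scaleT = tri_scale scaleA scaleM scaleB"
    and multT_def: "multT = tri_mult lM rM"
    and eA_def: "eA = tri_diag 1 0" and eB_def: "eB = tri_diag 0 1"
    and \<sigma>: "continuous_hom scaleT multT \<sigma>" "\<sigma> eA = eA" "\<sigma> eB = eB"
    and \<tau>: "continuous_hom scaleT multT \<tau>" "\<tau> eA = eA" "\<tau> eB = eB"
    and X: "unital_banach_bimodule scaleT multT tri_one scaleT multT tri_one scaleX lX rX"
    and XAA_def: "XAA = peirce lX rX eA eA" and XBB_def: "XBB = peirce lX rX eB eB"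
    and XAB: "peirce lX rX eA eB = {0}"
  shows "isomorphic_spaces
    (H1 scaleT multT scaleX UNIV lX rX \<sigma> \<tau>)
    (direct_sum_space
      (H1 scaleA (*) scaleX XAA
        (\<lambda>a. lX (tri_diag a 0)) (\<lambda>x a. rX x (tri_diag a 0)) (restrict_A \<sigma>) (restrict_A \<tau>))
      (H1 scaleB (*) scaleX XBB
        (\<lambda>b. lX (tri_diag 0 b)) (\<lambda>x b. rX x (tri_diag 0 b)) (restrict_B \<sigma>) (restrict_B \<tau>)))"
proof -
  interpret A: unital_banach_algebra scaleA by (rule A)
  interpret B: unital_banach_algebra scaleB by (rule B)
  interpret M: unital_banach_bimodule scaleA "(*)" 1 scaleB "(*)" 1 scaleM lM rM by (rule M)
  interpret X: unital_banach_bimodule scaleT multT tri_one scaleT multT tri_one scaleX lX rX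
    by (rule X)
  let ?iA = "\<lambda>a. tri_diag a 0 :: ('a, 'm, 'b) tri" and ?iB = "\<lambda>b. tri_diag 0 b :: ('a, 'm, 'b) tri"
  note tri_simps = multT_def eA_def eB_def tri_mult_def tri_diag_def M.L.zero_left M.L.zero_right
    M.R.zero_left M.R.zero_right M.lact_one M.ract_one
  have bl: "bounded_linear ?iA" "bounded_linear ?iB"
    by (rule bounded_linear_intro[where K = 1];
        simp add: tri_diag_def plus_tri_def scaleR_tri_def norm_tri_def)+
  note cont = linear_continuous_on[OF bl(1), of UNIV] linear_continuous_on[OF bl(2), of UNIV]
    linear_continuous_on[OF bounded_linear_tri_a, of UNIV]
    linear_continuous_on[OF bounded_linear_tri_b, of UNIV]
  have tri_eq: "tri_diag (tri_a t) 0 = multT (multT eA t) eA"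
    "tri_diag 0 (tri_b t) = multT (multT eB t) eB" for t
    by (simp_all add: tri_simps)
  have split: "eA + eB = tri_one"
    by (simp add: eA_def eB_def tri_one_def tri_diag_def plus_tri_def)
  have lower: "multT t eA = tri_diag (tri_a t) 0" "multT eB t = tri_diag 0 (tri_b t)" for t
    by (simp_all add: tri_simps)
  have idem: "multT eA eA = eA" "multT eB eB = eB"
    by (simp_all add: tri_simps)
  have hom: "\<phi> (multT s t) = multT (\<phi> s) (\<phi> t)" if "continuous_hom scaleT multT \<phi>" for \<phi> s t
    using that by (simp add: continuous_hom_def)
  have diag: "tri_a (\<phi> t) = restrict_A \<phi> (tri_a t)" "tri_b (\<phi> t) = restrict_B \<phi> (tri_b t)"
    if "continuous_hom scaleT multT \<phi>" "\<phi> eA = eA" "\<phi> eB = eB" for \<phi> t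
    unfolding restrict_A_def restrict_B_def tri_eq hom[OF that(1)] that(2,3)
    by (simp_all add: tri_simps)
  have incl: "\<phi> (?iA a) = ?iA (restrict_A \<phi> a)" "\<phi> (?iB b) = ?iB (restrict_B \<phi> b)"
    if "continuous_hom scaleT multT \<phi>" "\<phi> eA = eA" "\<phi> eB = eB" for \<phi> a b
    using restrict_A_eq[OF M] restrict_B_eq[OF M] that
    unfolding multT_def eA_def eB_def by blast+
  have upper: "rX (lX eA x) eB = 0" for x
    using XAB by (auto simp: peirce_def)
  (* The (A, B) entry of t maps e X e into e X f, which is zero; only the (A, A) entry survives. *)
  have XAA_right: "rX x t = rX x (tri_diag (tri_a t) 0)" if x: "x \<in> XAA" for x t
  proof -
    obtain y where y: "x = rX (lX eA y) eA"
      using x by (auto simp: XAA_def peirce_def)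
    have "rX x t = rX (lX eA (rX y (multT eA t))) tri_one"
      by (simp add: y X.ract_one X.lact_ract X.ract_mult)
    also have "\<dots> = rX (lX eA (rX y (multT eA t))) eA"
      by (simp add: split[symmetric] X.R.add_right upper)
    also have "\<dots> = rX x (tri_diag (tri_a t) 0)"
      by (simp add: y tri_eq X.lact_ract X.ract_mult[symmetric]) (simp add: tri_simps)
    finally show ?thesis .
  qed
  (* For the same reason the (A, B) entry annihilates f X f from the left. *)
  have XBB_left: "lX t x = lX (tri_diag 0 (tri_b t)) x" if x: "x \<in> XBB" for x t
  proof -
    obtain y where y: "x = rX (lX eB y) eB"
      using x by (auto simp: XBB_def peirce_def)
    have "lX t x = lX tri_one (rX (lX (multT t eB) y) eB)"
      by (simp add: y X.lact_one X.lact_ract X.lact_mult)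
    also have "\<dots> = lX eB (rX (lX (multT t eB) y) eB)"
      by (simp add: split[symmetric] X.L.add_left X.R.add_left X.lact_ract upper)
    also have "\<dots> = lX (tri_diag 0 (tri_b t)) x"
      by (simp add: y tri_eq X.lact_ract X.lact_mult[symmetric]) (simp add: tri_simps)
    finally show ?thesis .
  qed
  have XAA_left: "lX t x = lX (tri_diag (tri_a t) 0) x" if "x \<in> XAA" for x t
    using that by (auto simp: XAA_def peirce_def X.lact_ract X.lact_mult[symmetric] lower tri_diag_def)
  have XBB_right: "rX x t = rX x (tri_diag 0 (tri_b t))" if "x \<in> XBB" for x t
    using that by (auto simp: XBB_def peirce_def X.ract_mult[symmetric] lower tri_diag_def)
  interpret cA: bimodule_corner scaleT multT tri_one scaleX lX rX scaleA "(*)" eA ?iA tri_a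
    \<sigma> \<tau> "restrict_A \<sigma>" "restrict_A \<tau>"
  proof unfold_locales
    fix x t
    assume "x \<in> peirce lX rX eA eA"
    then show "lX t x = lX (?iA (tri_a t)) x" "rX x t = rX x (?iA (tri_a t))"
      unfolding XAA_def[symmetric] by (fact XAA_left XAA_right)+
  qed (fact cont idem diag[OF \<sigma>] diag[OF \<tau>] incl[OF \<sigma>] incl[OF \<tau>] |
      simp add: tri_simps scaleT_def tri_scale_def plus_tri_def)+
  interpret cB: bimodule_corner scaleT multT tri_one scaleX lX rX scaleB "(*)" eB ?iB tri_b
    \<sigma> \<tau> "restrict_B \<sigma>" "restrict_B \<tau>"
  proof unfold_locales
    fix x t
    assume "x \<in> peirce lX rX eB eB"
    then show "lX t x = lX (?iB (tri_b t)) x" "rX x t = rX x (?iB (tri_b t))"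
      unfolding XBB_def[symmetric] by (fact XBB_left XBB_right)+
  qed (fact cont idem diag[OF \<sigma>] diag[OF \<tau>] incl[OF \<sigma>] incl[OF \<tau>] |
      simp add: tri_simps scaleT_def tri_scale_def plus_tri_def)+
  interpret F: vector_space "\<lambda>c d t. scaleX c (d t)"
    by (rule vector_space_pointwise[OF X.vector_space_axioms])
  have Z: "F.subspace cA.ZT"
    by (rule subspace_Z1[OF X.A.vector_space_axioms X.banach_space_axioms X.subspace_UNIV
          X.linear_lact X.linear_ract])
  have Bd: "F.subspace cA.BT"
    by (rule subspace_B1[OF X.A.vector_space_axioms X.banach_space_axioms X.subspace_UNIV
          X.linear_lact X.linear_ract])
  have BA: "module.subspace (\<lambda>c d t. scaleX c (d t)) cA.BC"
    by (rule subspace_B1[OF A.vector_space_axioms X.banach_space_axioms cA.subspace_corner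
          X.linear_lact X.linear_ract])
  have BB: "module.subspace (\<lambda>c d t. scaleX c (d t)) cB.BC"
    by (rule subspace_B1[OF B.vector_space_axioms X.banach_space_axioms cB.subspace_corner
          X.linear_lact X.linear_ract])
  interpret pA: Vector_Spaces.linear "\<lambda>c d t. scaleX c (d t)" "\<lambda>c d t. scaleX c (d t)" cA.compress
    by (rule cA.linear_compress)
  interpret pB: Vector_Spaces.linear "\<lambda>c d t. scaleX c (d t)" "\<lambda>c d t. scaleX c (d t)" cB.compress
    by (rule cB.linear_compress)
  have compress_sum: "cA.compress ((dA \<circ> tri_a) + (dB \<circ> tri_b)) = dA"
    "cB.compress ((dA \<circ> tri_a) + (dB \<circ> tri_b)) = dB" if "dA \<in> cA.ZC" "dB \<in> cB.ZC" for dA dB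
  proof -
    have d: "Vector_Spaces.linear scaleA scaleX dA" "Vector_Spaces.linear scaleB scaleX dB"
      using that by (auto simp: Z1_def is_derivation_def)
    have "cA.compress (dB \<circ> tri_b) = 0"
      by (rule cA.compress_extend_orthogonal[OF d(2)]) (simp add: tri_diag_def)
    moreover have "cB.compress (dA \<circ> tri_a) = 0"
      by (rule cB.compress_extend_orthogonal[OF d(1)]) (simp add: tri_diag_def)
    ultimately show "cA.compress ((dA \<circ> tri_a) + (dB \<circ> tri_b)) = dA"
      "cB.compress ((dA \<circ> tri_a) + (dB \<circ> tri_b)) = dB"
      using that by (simp_all add: pA.add pB.add cA.compress_extend cB.compress_extend)
  qed
  have inner: "D \<in> cA.BT" if "D \<in> cA.ZT" "cA.compress D = 0" "cB.compress D = 0" for D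
  proof -
    have "Vector_Spaces.linear scaleT scaleX D"
      and D_mult: "D (multT s t) = rX (D s) (\<sigma> t) + lX (\<tau> s) (D t)" for s t
      using that by (auto simp: Z1_def is_derivation_def)
    then have D_add: "D (s + t) = D s + D t" for s t
      unfolding Vector_Spaces.linear_iff by blast
    have "D t = lX (\<tau> t) (- D eA) - rX (- D eA) (\<sigma> t)" for t
    proof (rule derivation_inner_if_corners_vanish[where D = D and \<sigma> = \<sigma> and \<tau> = \<tau> and e = eA and f = eB,
          OF X])
      show "multT (multT eB t) eA = 0" for t
        by (simp add: tri_simps zero_tri_def)
      show "rX (lX eA (D (multT t eA))) eA = 0" "rX (lX eB (D (multT eB t))) eB = 0" for t
        using that(2,3) by (simp_all add: lower cA.compress_def cB.compress_def fun_eq_iff)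
    qed (fact D_add D_mult hom[OF \<sigma>(1)] hom[OF \<tau>(1)] \<sigma> \<tau> idem split upper)+
    then have "is_inner UNIV lX rX \<sigma> \<tau> D"
      unfolding is_inner_def by blast
    with that(1) show ?thesis
      by (simp add: B1_def)
  qed
  show ?thesis
    unfolding H1_def XAA_def XBB_def
  proof (rule isomorphic_quotients[OF cA.linear_compress cB.linear_compress Z Bd BA BB])
    fix D
    assume D: "D \<in> cA.ZT" "cA.compress D \<in> cA.BC" "cB.compress D \<in> cB.BC"
    (* The corners of D, extended back to T, are inner; the rest of D has vanishing corners. *)
    define L :: "('a, 'm, 'b) tri \<Rightarrow> 'x"
      where "L = (cA.compress D \<circ> tri_a) + (cB.compress D \<circ> tri_b)"
    have L: "L \<in> cA.BT"
      unfolding L_def using D cA.extend_B1 cB.extend_B1 by (intro F.subspace_add[OF Bd])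
    then have "D - L \<in> cA.ZT"
      by (intro F.subspace_diff[OF Z] D) (simp add: B1_def)
    moreover have "cA.compress (D - L) = 0" "cB.compress (D - L) = 0"
      using compress_sum[of "cA.compress D" "cB.compress D"] D
      by (simp_all add: L_def pA.diff pB.diff B1_def)
    ultimately have "D - L \<in> cA.BT"
      by (rule inner)
    then show "D \<in> cA.BT"
      using F.subspace_add[OF Bd _ L] by fastforce
  next
    fix dA dB
    assume "dA \<in> cA.ZC" "dB \<in> cB.ZC"
    then show "\<exists>D\<in>cA.ZT. cA.compress D = dA \<and> cB.compress D = dB"
      using F.subspace_add[OF Z] cA.extend_Z1 cB.extend_Z1 compress_sum by blast
  qed (use cA.compress_Z1 cB.compress_Z1 cA.compress_B1 cB.compress_B1 in auto)
qed

end
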